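(* Let $\mathbb{C}$ be a unital category. Let $k:X\to A$ and $l:Y\to A$ be monomorphisms in $\mathbb{C}$, let $r_1,r_2:R\to A$ and $s_1,s_2:S\to A$ be (internal) equivalence relations on $A$, and let $\kappa:X\to R$ and $\lambda:Y\to S$ be morphisms such that $$\langle r_1,r_2\rangle\kappa=\langle 1,0\rangle k \quad\text{and}\quad \langle s_1,s_2\rangle\lambda=\langle 0,1\rangle l$$ and both of these commutative squares are pullbacks (the first exhibits $X$ as the pullback of $\langle r_1,r_2\rangle:R\to A\times A$ along $\langle 1,0\rangle:A\to A\times A$, the second exhibits $Y$ as the pullback of $\langle s_1,s_2\rangle:S\to A\times A$ along $\langle 0,1\rangle:A\to A\times A$). Let $R\,\square^0 S$, $\theta:R\,\square^0 S\to X\times Y$, $\alpha:X\to R\,\square^0 S$ and $\beta:Y\to R\,\square^0 S$ be the object and morphisms constructed from these data as described in the context. Then the following conditions are equivalent: (a) $k:X\to A$ and $l:Y\to A$ Huq-commute; (b) $\alpha:X\to R\,\square^0 S$ and $\beta:Y\to R\,\square^0 S$ Huq-commute; (c) $\theta$ is a split epimorphism of cospans with domain $(R\,\square^0 S,\alpha,\beta)$ and codomain $(X\times Y,\langle 1,0\rangle,\langle 0,1\rangle)$, that is, there is a morphism $\sigma:X\times Y\to R\,\square^0 S$ with $\theta\sigma=1_{X\times Y}$, $\sigma\langle 1,0\rangle=\alpha$ and $\sigma\langle 0,1\rangle=\beta$.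
   Context: In a pointed category, $0$ denotes the zero object and also every zero morphism. For $f:W\to X$, $g:W\to Y$, $\langle f,g\rangle:W\to X\times Y$ is the induced morphism into the product; $\pi_1,\pi_2$ denote product projections. A category $\mathbb{C}$ is unital if it is pointed, finitely complete, and for all objects $X,Y$ the morphisms $\langle 1,0\rangle:X\to X\times Y$ and $\langle 0,1\rangle:Y\to X\times Y$ are jointly strongly epimorphic. Morphisms $f:X\to A$ and $g:Y\to A$ in a unital category Huq-commute if there is a (necessarily unique) morphism $\varphi:X\times Y\to A$ with $\varphi\langle 1,0\rangle=f$ and $\varphi\langle 0,1\rangle=g$; $\varphi$ is called the cooperator of $f$ and $g$. Construction of $R\,\square^0 S$ and $\theta$: let $P$ with $p_1:P\to S$ and $p_2:P\to R$ be the pullback of $s_2:S\to A$ and $r_1:R\to A$ (so $s_2p_1=r_1p_2$). Then $R\,\square^0 S$, with $\theta:R\,\square^0 S\to X\times Y$ and $\psi:R\,\square^0 S\to P$, is the pullback of $k\times l:X\times Y\to A\times A$ and $\langle s_1p_1,r_2p_2\rangle:P\to A\times A$ (so $(k\times l)\theta=\langle s_1p_1,r_2p_2\rangle\psi$). Equivalently, $R\,\square^0 S$ is the limit of the diagram formed by $k:X\to A$, $s_1:S\to A$; $s_2:S\to A$, $r_1:R\to A$; $r_2:R\to A$, $l:Y\to A$, with limit projections $\pi_1\theta$ to $X$, $p_1\psi$ to $S$, $p_2\psi$ to $R$, $\pi_2\theta$ to $Y$. (In pointed sets its elements are the triples $(x,a,y)\in X\times A\times Y$ with $(k(x),a)\in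 S$ and $(a,l(y))\in R$.) Construction of $\alpha$ and $\beta$: let $e_R:A\to R$ and $e_S:A\to S$ be the reflexivity morphisms ($r_1e_R=r_2e_R=1_A$, $s_1e_S=s_2e_S=1_A$). Then $\alpha:X\to R\,\square^0 S$ is the unique morphism with $\pi_1\theta\alpha=1_X$, $p_1\psi\alpha=e_Sk$, $p_2\psi\alpha=\kappa$, $\pi_2\theta\alpha=0$, and $\beta:Y\to R\,\square^0 S$ is the unique morphism with $\pi_1\theta\beta=0$, $p_1\psi\beta=\lambda$, $p_2\psi\beta=e_Rl$, $\pi_2\theta\beta=1_Y$. In particular $\theta\alpha=\langle 1,0\rangle$ and $\theta\beta=\langle 0,1\rangle$. *)

theory Defs
  imports Main
begin

section \<open>Categories\<close>

record ('o, 'm) category =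
  Obj :: "'o set"
  Arr :: "'m set"
  Dom :: "'m \<Rightarrow> 'o"
  Cod :: "'m \<Rightarrow> 'o"
  Ident :: "'o \<Rightarrow> 'm"
  Comp :: "'m \<Rightarrow> 'm \<Rightarrow> 'm"  (infixl "\<cdot>\<index>" 70)

text \<open>Composition is written in the applicative order: \<open>g \<cdot> f\<close> is \<open>f\<close> followed by \<open>g\<close>.\<close>

definition Hom :: "('o, 'm) category \<Rightarrow> 'o \<Rightarrow> 'o \<Rightarrow> 'm set" where
  "Hom C X Y = {f \<in> Arr C. Dom C f = X \<and> Cod C f = Y}"

locale category =
  fixes C :: "('o, 'm) category" (structure)
  assumes Dom_in: "f \<in> Arr C \<Longrightarrow> Dom C f \<in> Obj C"
    and Cod_in: "f \<in> Arr C \<Longrightarrow> Cod C f \<in> Obj C"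
    and Ident_in: "X \<in> Obj C \<Longrightarrow> Ident C X \<in> Hom C X X"
    and Comp_in: "f \<in> Hom C X Y \<Longrightarrow> g \<in> Hom C Y Z \<Longrightarrow> g \<cdot> f \<in> Hom C X Z"
    and Ident_left: "f \<in> Hom C X Y \<Longrightarrow> Ident C Y \<cdot> f = f"
    and Ident_right: "f \<in> Hom C X Y \<Longrightarrow> f \<cdot> Ident C X = f"
    and Comp_assoc: "f \<in> Hom C W X \<Longrightarrow> g \<in> Hom C X Y \<Longrightarrow> h \<in> Hom C Y Z \<Longrightarrow>
                       h \<cdot> (g \<cdot> f) = (h \<cdot> g) \<cdot> f"

definition monic :: "('o, 'm) category \<Rightarrow> 'm \<Rightarrow> bool" where
  "monic C m \<longleftrightarrow> m \<in> Arr C \<and>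
     (\<forall>W. \<forall>u\<in>Hom C W (Dom C m). \<forall>v\<in>Hom C W (Dom C m). m \<cdot>\<^bsub>C\<^esub> u = m \<cdot>\<^bsub>C\<^esub> v \<longrightarrow> u = v)"

definition jointly_monic :: "('o, 'm) category \<Rightarrow> 'm \<Rightarrow> 'm \<Rightarrow> bool" where
  "jointly_monic C f g \<longleftrightarrow> f \<in> Arr C \<and> g \<in> Arr C \<and> Dom C f = Dom C g \<and>
     (\<forall>W. \<forall>u\<in>Hom C W (Dom C f). \<forall>v\<in>Hom C W (Dom C f).
        f \<cdot>\<^bsub>C\<^esub> u = f \<cdot>\<^bsub>C\<^esub> v \<and> g \<cdot>\<^bsub>C\<^esub> u = g \<cdot>\<^bsub>C\<^esub> v \<longrightarrow> u = v)"

definition jointly_epic :: "('o, 'm) category \<Rightarrow> 'm \<Rightarrow> 'm \<Rightarrow> bool" where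
  "jointly_epic C f g \<longleftrightarrow> f \<in> Arr C \<and> g \<in> Arr C \<and> Cod C f = Cod C g \<and>
     (\<forall>Z. \<forall>u\<in>Hom C (Cod C f) Z. \<forall>v\<in>Hom C (Cod C f) Z.
        u \<cdot>\<^bsub>C\<^esub> f = v \<cdot>\<^bsub>C\<^esub> f \<and> u \<cdot>\<^bsub>C\<^esub> g = v \<cdot>\<^bsub>C\<^esub> g \<longrightarrow> u = v)"

text \<open>
  A pair is jointly strongly epimorphic if it is jointly epimorphic and left orthogonal to every
  monomorphism. Uniqueness of the diagonal, and its compatibility with \<open>u\<close> and \<open>v\<close>, are automatic
  because \<open>m\<close> is a monomorphism.
\<close>

definition jointly_strongly_epic :: "('o, 'm) category \<Rightarrow> 'm \<Rightarrow> 'm \<Rightarrow> bool" where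
  "jointly_strongly_epic C f g \<longleftrightarrow> jointly_epic C f g \<and>
     (\<forall>m h u v. monic C m \<and> h \<in> Hom C (Cod C f) (Cod C m) \<and>
        u \<in> Hom C (Dom C f) (Dom C m) \<and> v \<in> Hom C (Dom C g) (Dom C m) \<and>
        m \<cdot>\<^bsub>C\<^esub> u = h \<cdot>\<^bsub>C\<^esub> f \<and> m \<cdot>\<^bsub>C\<^esub> v = h \<cdot>\<^bsub>C\<^esub> g \<longrightarrow>
        (\<exists>d\<in>Hom C (Cod C f) (Dom C m). m \<cdot>\<^bsub>C\<^esub> d = h))"


section \<open>Finite limits\<close>

definition is_functor ::
  "('i, 'j) category \<Rightarrow> ('o, 'm) category \<Rightarrow> ('i \<Rightarrow> 'o) \<Rightarrow> ('j \<Rightarrow> 'm) \<Rightarrow> bool" where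
  "is_functor J C Fo Fa \<longleftrightarrow>
     (\<forall>i\<in>Obj J. Fo i \<in> Obj C \<and> Fa (Ident J i) = Ident C (Fo i)) \<and>
     (\<forall>f\<in>Arr J. Fa f \<in> Hom C (Fo (Dom J f)) (Fo (Cod J f))) \<and>
     (\<forall>f\<in>Arr J. \<forall>g\<in>Arr J. Cod J f = Dom J g \<longrightarrow> Fa (g \<cdot>\<^bsub>J\<^esub> f) = Fa g \<cdot>\<^bsub>C\<^esub> Fa f)"

definition is_cone ::
  "('i, 'j) category \<Rightarrow> ('o, 'm) category \<Rightarrow> ('i \<Rightarrow> 'o) \<Rightarrow> ('j \<Rightarrow> 'm) \<Rightarrow> 'o \<Rightarrow> ('i \<Rightarrow> 'm) \<Rightarrow> bool" where
  "is_cone J C Fo Fa L c \<longleftrightarrow> L \<in> Obj C \<and> (\<forall>i\<in>Obj J. c i \<in> Hom C L (Fo i)) \<and>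
     (\<forall>f\<in>Arr J. Fa f \<cdot>\<^bsub>C\<^esub> c (Dom J f) = c (Cod J f))"

definition is_limit ::
  "('i, 'j) category \<Rightarrow> ('o, 'm) category \<Rightarrow> ('i \<Rightarrow> 'o) \<Rightarrow> ('j \<Rightarrow> 'm) \<Rightarrow> 'o \<Rightarrow> ('i \<Rightarrow> 'm) \<Rightarrow> bool" where
  "is_limit J C Fo Fa L c \<longleftrightarrow> is_cone J C Fo Fa L c \<and>
     (\<forall>W d. is_cone J C Fo Fa W d \<longrightarrow>
        (\<exists>!h. h \<in> Hom C W L \<and> (\<forall>i\<in>Obj J. c i \<cdot>\<^bsub>C\<^esub> h = d i)))"

text \<open>
  Every finite category is isomorphic to one whose objects and arrows are natural numbers, so it
  suffices to let the index categories range over these.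
\<close>

definition finitely_complete :: "('o, 'm) category \<Rightarrow> bool" where
  "finitely_complete C \<longleftrightarrow>
     (\<forall>(J :: (nat, nat) category) Fo Fa.
        category J \<and> finite (Obj J) \<and> finite (Arr J) \<and> is_functor J C Fo Fa \<longrightarrow>
        (\<exists>L c. is_limit J C Fo Fa L c))"

text \<open>\<open>P\<close> with projections \<open>p\<^sub>1\<close>, \<open>p\<^sub>2\<close> is a product of \<open>X\<close> and \<open>Y\<close>.\<close>

definition is_product :: "('o, 'm) category \<Rightarrow> 'o \<Rightarrow> 'o \<Rightarrow> 'o \<Rightarrow> 'm \<Rightarrow> 'm \<Rightarrow> bool" where
  "is_product C X Y P p\<^sub>1 p\<^sub>2 \<longleftrightarrow> X \<in> Obj C \<and> Y \<in> Obj C \<and> p\<^sub>1 \<in> Hom C P X \<and> p\<^sub>2 \<in> Hom C P Y \<and>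
     (\<forall>W. \<forall>f\<in>Hom C W X. \<forall>g\<in>Hom C W Y.
        \<exists>!h. h \<in> Hom C W P \<and> p\<^sub>1 \<cdot>\<^bsub>C\<^esub> h = f \<and> p\<^sub>2 \<cdot>\<^bsub>C\<^esub> h = g)"

text \<open>The induced morphism \<open>\<langle>f, g\<rangle>\<close> into the product with projections \<open>p\<^sub>1\<close>, \<open>p\<^sub>2\<close>.\<close>

definition pairing :: "('o, 'm) category \<Rightarrow> 'm \<Rightarrow> 'm \<Rightarrow> 'm \<Rightarrow> 'm \<Rightarrow> 'm" where
  "pairing C p\<^sub>1 p\<^sub>2 f g =
     (THE h. h \<in> Hom C (Dom C f) (Dom C p\<^sub>1) \<and> p\<^sub>1 \<cdot>\<^bsub>C\<^esub> h = f \<and> p\<^sub>2 \<cdot>\<^bsub>C\<^esub> h = g)"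

text \<open>
  \<open>f \<times> g\<close>, from the product with projections \<open>p\<^sub>1\<close>, \<open>p\<^sub>2\<close> to the product with projections
  \<open>q\<^sub>1\<close>, \<open>q\<^sub>2\<close>.
\<close>

definition prod_arr :: "('o, 'm) category \<Rightarrow> 'm \<Rightarrow> 'm \<Rightarrow> 'm \<Rightarrow> 'm \<Rightarrow> 'm \<Rightarrow> 'm \<Rightarrow> 'm" where
  "prod_arr C p\<^sub>1 p\<^sub>2 q\<^sub>1 q\<^sub>2 f g = pairing C q\<^sub>1 q\<^sub>2 (f \<cdot>\<^bsub>C\<^esub> p\<^sub>1) (g \<cdot>\<^bsub>C\<^esub> p\<^sub>2)"

text \<open>\<open>P\<close> with \<open>p\<close>, \<open>q\<close> is a pullback of \<open>f\<close> and \<open>g\<close>; the square is \<open>f \<cdot> p = g \<cdot> q\<close>.\<close>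

definition is_pullback :: "('o, 'm) category \<Rightarrow> 'o \<Rightarrow> 'm \<Rightarrow> 'm \<Rightarrow> 'm \<Rightarrow> 'm \<Rightarrow> bool" where
  "is_pullback C P p q f g \<longleftrightarrow> f \<in> Arr C \<and> g \<in> Arr C \<and> Cod C f = Cod C g \<and>
     p \<in> Hom C P (Dom C f) \<and> q \<in> Hom C P (Dom C g) \<and> f \<cdot>\<^bsub>C\<^esub> p = g \<cdot>\<^bsub>C\<^esub> q \<and>
     (\<forall>W. \<forall>u\<in>Hom C W (Dom C f). \<forall>v\<in>Hom C W (Dom C g). f \<cdot>\<^bsub>C\<^esub> u = g \<cdot>\<^bsub>C\<^esub> v \<longrightarrow>
        (\<exists>!h. h \<in> Hom C W P \<and> p \<cdot>\<^bsub>C\<^esub> h = u \<and> q \<cdot>\<^bsub>C\<^esub> h = v))"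


section \<open>Unital categories\<close>

definition zero_object :: "('o, 'm) category \<Rightarrow> 'o \<Rightarrow> bool" where
  "zero_object C Z \<longleftrightarrow> Z \<in> Obj C \<and>
     (\<forall>X\<in>Obj C. (\<exists>!f. f \<in> Hom C X Z) \<and> (\<exists>!f. f \<in> Hom C Z X))"

definition pointed :: "('o, 'm) category \<Rightarrow> bool" where
  "pointed C \<longleftrightarrow> (\<exists>Z. zero_object C Z)"

definition zero_arr :: "('o, 'm) category \<Rightarrow> 'o \<Rightarrow> 'o \<Rightarrow> 'm" where
  "zero_arr C X Y =
     (THE f. \<exists>Z g h. zero_object C Z \<and> g \<in> Hom C X Z \<and> h \<in> Hom C Z Y \<and> f = h \<cdot>\<^bsub>C\<^esub> g)"

text \<open>\<open>\<langle>1, 0\<rangle> : X \<rightarrow> X \<times> Y\<close> and \<open>\<langle>0, 1\<rangle> : Y \<rightarrow> X \<times> Y\<close>, for the product with projections \<open>p\<^sub>1\<close>, \<open>p\<^sub>2\<close>.\<close>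

definition inj1 :: "('o, 'm) category \<Rightarrow> 'm \<Rightarrow> 'm \<Rightarrow> 'm" where
  "inj1 C p\<^sub>1 p\<^sub>2 = pairing C p\<^sub>1 p\<^sub>2 (Ident C (Cod C p\<^sub>1)) (zero_arr C (Cod C p\<^sub>1) (Cod C p\<^sub>2))"

definition inj2 :: "('o, 'm) category \<Rightarrow> 'm \<Rightarrow> 'm \<Rightarrow> 'm" where
  "inj2 C p\<^sub>1 p\<^sub>2 = pairing C p\<^sub>1 p\<^sub>2 (zero_arr C (Cod C p\<^sub>2) (Cod C p\<^sub>1)) (Ident C (Cod C p\<^sub>2))"

locale unital_category = category C for C :: "('o, 'm) category" (structure) +
  assumes pointed: "pointed C"
    and finitely_complete: "finitely_complete C"
    and unital: "is_product C X Y P p\<^sub>1 p\<^sub>2 \<Longrightarrow>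
                   jointly_strongly_epic C (inj1 C p\<^sub>1 p\<^sub>2) (inj2 C p\<^sub>1 p\<^sub>2)"

text \<open>
  Products are not chosen; in a category with binary products the condition below does not depend
  on the choice of the product \<open>P\<close>. The morphism \<open>\<phi>\<close> is the cooperator of \<open>f\<close> and \<open>g\<close>.
\<close>

definition huq_commute :: "('o, 'm) category \<Rightarrow> 'm \<Rightarrow> 'm \<Rightarrow> bool" where
  "huq_commute C f g \<longleftrightarrow> f \<in> Arr C \<and> g \<in> Arr C \<and> Cod C f = Cod C g \<and>
     (\<exists>P p\<^sub>1 p\<^sub>2 \<phi>. is_product C (Dom C f) (Dom C g) P p\<^sub>1 p\<^sub>2 \<and> \<phi> \<in> Hom C P (Cod C f) \<and>
        \<phi> \<cdot>\<^bsub>C\<^esub> inj1 C p\<^sub>1 p\<^sub>2 = f \<and> \<phi> \<cdot>\<^bsub>C\<^esub> inj2 C p\<^sub>1 p\<^sub>2 = g)"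


section \<open>Internal equivalence relations\<close>

text \<open>
  Transitivity refers to the object \<open>T = R \<times>\<^sub>A R\<close> of composable pairs, the pullback of \<open>r\<^sub>2\<close> and
  \<open>r\<^sub>1\<close>, which exists in a finitely complete category.
\<close>

definition internal_equivalence ::
  "('o, 'm) category \<Rightarrow> 'o \<Rightarrow> 'o \<Rightarrow> 'm \<Rightarrow> 'm \<Rightarrow> bool" where
  "internal_equivalence C A R r\<^sub>1 r\<^sub>2 \<longleftrightarrow> r\<^sub>1 \<in> Hom C R A \<and> r\<^sub>2 \<in> Hom C R A \<and> jointly_monic C r\<^sub>1 r\<^sub>2 \<and>
     (\<exists>e\<in>Hom C A R. r\<^sub>1 \<cdot>\<^bsub>C\<^esub> e = Ident C A \<and> r\<^sub>2 \<cdot>\<^bsub>C\<^esub> e = Ident C A) \<and>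
     (\<exists>s\<in>Hom C R R. r\<^sub>1 \<cdot>\<^bsub>C\<^esub> s = r\<^sub>2 \<and> r\<^sub>2 \<cdot>\<^bsub>C\<^esub> s = r\<^sub>1) \<and>
     (\<forall>T t\<^sub>1 t\<^sub>2. is_pullback C T t\<^sub>1 t\<^sub>2 r\<^sub>2 r\<^sub>1 \<longrightarrow>
        (\<exists>t\<in>Hom C T R. r\<^sub>1 \<cdot>\<^bsub>C\<^esub> t = r\<^sub>1 \<cdot>\<^bsub>C\<^esub> t\<^sub>1 \<and> r\<^sub>2 \<cdot>\<^bsub>C\<^esub> t = r\<^sub>2 \<cdot>\<^bsub>C\<^esub> t\<^sub>2))"


section \<open>Cospans\<close>

text \<open>\<open>h\<close> is a morphism of cospans \<open>(W, f, g) \<rightarrow> (Z, u, v)\<close> over a fixed pair of objects.\<close>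

definition cospan_morphism ::
  "('o, 'm) category \<Rightarrow> 'o \<times> 'm \<times> 'm \<Rightarrow> 'o \<times> 'm \<times> 'm \<Rightarrow> 'm \<Rightarrow> bool" where
  "cospan_morphism C = (\<lambda>(W, f, g) (Z, u, v) h.
     h \<in> Hom C W Z \<and> h \<cdot>\<^bsub>C\<^esub> f = u \<and> h \<cdot>\<^bsub>C\<^esub> g = v)"

definition split_epi_of_cospans ::
  "('o, 'm) category \<Rightarrow> 'o \<times> 'm \<times> 'm \<Rightarrow> 'o \<times> 'm \<times> 'm \<Rightarrow> 'm \<Rightarrow> bool" where
  "split_epi_of_cospans C U V h \<longleftrightarrow> cospan_morphism C U V h \<and>
     (\<exists>\<sigma>. cospan_morphism C V U \<sigma> \<and> h \<cdot>\<^bsub>C\<^esub> \<sigma> = Ident C (fst V))"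

end

theory Submission
  imports Defs
begin

text \<open>
  Let \<open>\<phi>\<close> be a cooperator of \<open>k\<close> and \<open>l\<close>. The morphism \<open>\<langle>k\<pi>\<^sub>1, \<phi>\<rangle>\<close> restricts to \<open>\<langle>k, k\<rangle>\<close> and \<open>\<langle>0, l\<rangle>\<close>
  along \<open>\<langle>1, 0\<rangle>\<close> and \<open>\<langle>0, 1\<rangle>\<close>; both factor through \<open>S\<close>, by reflexivity and by \<open>\<lambda>\<close>. As
  \<open>S \<rightarrow> A \<times> A\<close> is monic and \<open>\<langle>1, 0\<rangle>\<close>, \<open>\<langle>0, 1\<rangle>\<close> are jointly strongly epic, \<open>\<langle>k\<pi>\<^sub>1, \<phi>\<rangle>\<close> factors
  through \<open>S\<close>. Likewise \<open>\<langle>\<phi>, l\<pi>\<^sub>2\<rangle>\<close> factors through \<open>R\<close>. The two factorizations induce the section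
  of \<open>\<theta>\<close>. Conversely, composing a cooperator of \<open>\<alpha>\<close> and \<open>\<beta>\<close> with the middle projection
  \<open>s\<^sub>2p\<^sub>1\<psi>\<close> gives a cooperator of \<open>k\<close> and \<open>l\<close>, and composing it with \<open>\<theta>\<close> gives the identity because
  \<open>\<langle>1, 0\<rangle>\<close> and \<open>\<langle>0, 1\<rangle>\<close> are jointly epic.
\<close>

section \<open>Hom-sets, zero morphisms, products and pullbacks in a category\<close>

lemma Hom_Arr: "f \<in> Hom C X Y \<Longrightarrow> f \<in> Arr C"
  and Hom_Dom: "f \<in> Hom C X Y \<Longrightarrow> Dom C f = X"
  and Hom_Cod: "f \<in> Hom C X Y \<Longrightarrow> Cod C f = Y"
  by (simp_all add: Hom_def)

context category
begin

lemma Hom_Obj: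
  assumes "f \<in> Hom C X Y"
  shows "X \<in> Obj C" and "Y \<in> Obj C"
  using assms Dom_in Cod_in by (auto simp: Hom_def)

lemma into_zero_unique:
  assumes Z: "zero_object C Z" and f: "f \<in> Hom C X Z" and g: "g \<in> Hom C X Z"
  shows "f = g"
proof -
  have "\<exists>!f. f \<in> Hom C X Z"
    using Z Hom_Obj(1)[OF f] by (simp add: zero_object_def)
  then show ?thesis
    using f g by blast
qed

lemma from_zero_unique:
  assumes Z: "zero_object C Z" and f: "f \<in> Hom C Z X" and g: "g \<in> Hom C Z X"
  shows "f = g"
proof -
  have "\<exists>!f. f \<in> Hom C Z X"
    using Z Hom_Obj(2)[OF f] by (simp add: zero_object_def)
  then show ?thesis
    using f g by blast
qed

text \<open>\<open>zero_arr\<close> is a definite description over all zero objects and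
  factorizations, so it has a value only once all the composites agree. Uniqueness of morphisms into
  and out of zero objects gives this.\<close>

lemma zero_arr_eq:
  assumes Z: "zero_object C Z" and g: "g \<in> Hom C X Z" and h: "h \<in> Hom C Z Y"
  shows "zero_arr C X Y = h \<cdot> g"
  unfolding zero_arr_def
proof (rule the_equality)
  show "\<exists>Z g' h'. zero_object C Z \<and> g' \<in> Hom C X Z \<and> h' \<in> Hom C Z Y \<and> h \<cdot> g = h' \<cdot> g'"
    using assms by blast
next
  fix f
  assume "\<exists>Z' g' h'. zero_object C Z' \<and> g' \<in> Hom C X Z' \<and> h' \<in> Hom C Z' Y \<and> f = h' \<cdot> g'"
  then obtain Z' g' h' where Z': "zero_object C Z'" and g': "g' \<in> Hom C X Z'"
    and h': "h' \<in> Hom C Z' Y" and f: "f = h' \<cdot> g'" by blast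
  \<comment> \<open>The comparison morphism between the two zero objects turns one factorization
    into the other.\<close>
  obtain c where c: "c \<in> Hom C Z Z'"
    using Z Hom_Obj(2)[OF g'] unfolding zero_object_def by auto
  have "c \<cdot> g = g'" "h' \<cdot> c = h"
    using into_zero_unique[OF Z' Comp_in[OF g c] g'] from_zero_unique[OF Z Comp_in[OF c h'] h]
    by simp_all
  then show "f = h \<cdot> g"
    using f Comp_assoc[OF g c h'] by simp
qed

lemma product_eqI:
  assumes "is_product C X Y P p q" and "u \<in> Hom C W P" and "v \<in> Hom C W P"
    and "p \<cdot> u = p \<cdot> v" and "q \<cdot> u = q \<cdot> v"
  shows "u = v"
proof -
  have "p \<cdot> u \<in> Hom C W X" "q \<cdot> u \<in> Hom C W Y"
    using assms(1) Comp_in[OF assms(2)] unfolding is_product_def by blast+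
  then have "\<exists>!h. h \<in> Hom C W P \<and> p \<cdot> h = p \<cdot> u \<and> q \<cdot> h = q \<cdot> u"
    using assms(1) unfolding is_product_def by blast
  then show ?thesis
    using assms by metis
qed

lemma pairing:
  assumes P: "is_product C X Y P p q" and f: "f \<in> Hom C W X" and g: "g \<in> Hom C W Y"
  shows pairing_in: "pairing C p q f g \<in> Hom C W P"
    and pairing_proj1: "p \<cdot> pairing C p q f g = f"
    and pairing_proj2: "q \<cdot> pairing C p q f g = g"
proof -
  have "\<exists>!h. h \<in> Hom C W P \<and> p \<cdot> h = f \<and> q \<cdot> h = g"
    using assms unfolding is_product_def by blast
  note this[THEN theI']
  moreover have "Dom C p = P" "Dom C f = W"
    using P f by (auto simp: is_product_def Hom_def)
  ultimately show "pairing C p q f g \<in> Hom C W P" "p \<cdot> pairing C p q f g = f"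
    "q \<cdot> pairing C p q f g = g"
    unfolding pairing_def by simp_all
qed

text \<open>Turns a relation, given as a jointly monic pair, into a single monomorphism, the form to
  which the orthogonality in \<open>jointly_strongly_epic\<close> applies.\<close>

lemma monic_pairing:
  assumes P: "is_product C X Y P p q" and r1: "r\<^sub>1 \<in> Hom C R X" and r2: "r\<^sub>2 \<in> Hom C R Y"
    and jm: "jointly_monic C r\<^sub>1 r\<^sub>2"
  shows "monic C (pairing C p q r\<^sub>1 r\<^sub>2)"
proof -
  let ?m = "pairing C p q r\<^sub>1 r\<^sub>2"
  note m = pairing[OF P r1 r2]
  have p: "p \<in> Hom C P X" and q: "q \<in> Hom C P Y"
    using P by (simp_all add: is_product_def)
  have "u = v" if u: "u \<in> Hom C W R" and v: "v \<in> Hom C W R" and eq: "?m \<cdot> u = ?m \<cdot> v" for W u v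
  proof -
    have "r\<^sub>1 \<cdot> u = r\<^sub>1 \<cdot> v"
      using Comp_assoc[OF u m(1) p] Comp_assoc[OF v m(1) p] eq m(2) by simp
    moreover have "r\<^sub>2 \<cdot> u = r\<^sub>2 \<cdot> v"
      using Comp_assoc[OF u m(1) q] Comp_assoc[OF v m(1) q] eq m(3) by simp
    ultimately show ?thesis
      using jm u v unfolding jointly_monic_def Hom_Dom[OF r1] by blast
  qed
  then show ?thesis
    using Hom_Arr[OF m(1)] unfolding monic_def Hom_Dom[OF m(1)] by blast
qed

lemma pullback_induced:
  assumes "is_pullback C P p q f g" and "f \<in> Hom C X Z" and "g \<in> Hom C Y Z"
    and "u \<in> Hom C W X" and "v \<in> Hom C W Y" and "f \<cdot> u = g \<cdot> v"
  obtains h where "h \<in> Hom C W P" and "p \<cdot> h = u" and "q \<cdot> h = v"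
  using assms(1,4-6) that
  unfolding is_pullback_def Hom_Dom[OF assms(2)] Hom_Dom[OF assms(3)] by blast

lemma pullback_eqI:
  assumes pb: "is_pullback C P p q f g" and u: "u \<in> Hom C W P" and v: "v \<in> Hom C W P"
    and "p \<cdot> u = p \<cdot> v" and "q \<cdot> u = q \<cdot> v"
  shows "u = v"
proof -
  have f: "f \<in> Hom C (Dom C f) (Cod C f)" and g: "g \<in> Hom C (Dom C g) (Cod C f)"
    and p: "p \<in> Hom C P (Dom C f)" and q: "q \<in> Hom C P (Dom C g)" and sq: "f \<cdot> p = g \<cdot> q"
    using pb by (auto simp: is_pullback_def Hom_def)
  have "f \<cdot> (p \<cdot> u) = g \<cdot> (q \<cdot> u)"
    using Comp_assoc[OF u p f] Comp_assoc[OF u q g] sq by simp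
  then have "\<exists>!h. h \<in> Hom C W P \<and> p \<cdot> h = p \<cdot> u \<and> q \<cdot> h = q \<cdot> u"
    using pb Comp_in[OF u p] Comp_in[OF u q] unfolding is_pullback_def by blast
  then show ?thesis
    using assms by metis
qed

end

section \<open>Zero morphisms and the product injections in a unital category\<close>

context unital_category
begin

text \<open>Exposes a factorization through a zero object; the typing of \<open>zero_arr\<close> and
  its absorption on both sides follow by reassociating it.\<close>

lemma zero_arr_factor:
  assumes "X \<in> Obj C" and "Y \<in> Obj C"
  obtains Z g h where "zero_object C Z" and "g \<in> Hom C X Z" and "h \<in> Hom C Z Y"
    and "zero_arr C X Y = h \<cdot> g"
proof -
  obtain Z where Z: "zero_object C Z"
    using pointed unfolding pointed_def by blast
  then have "\<exists>g. g \<in> Hom C X Z" "\<exists>h. h \<in> Hom C Z Y"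
    using assms by (auto simp: zero_object_def)
  then obtain g h where "g \<in> Hom C X Z" "h \<in> Hom C Z Y"
    by blast
  then show thesis
    using that[OF Z _ _ zero_arr_eq[OF Z]] by simp
qed

lemma zero_arr_in:
  assumes "X \<in> Obj C" and "Y \<in> Obj C"
  shows "zero_arr C X Y \<in> Hom C X Y"
  by (rule zero_arr_factor[OF assms]) (simp add: Comp_in)

lemma Comp_zero_arr:
  assumes "X \<in> Obj C" and f: "f \<in> Hom C Y Z"
  shows "f \<cdot> zero_arr C X Y = zero_arr C X Z"
proof (rule zero_arr_factor[OF assms(1) Hom_Obj(1)[OF f]])
  fix O' g h
  assume O': "zero_object C O'" and g: "g \<in> Hom C X O'" and h: "h \<in> Hom C O' Y"
    and "zero_arr C X Y = h \<cdot> g"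
  then show ?thesis
    using Comp_assoc[OF g h f] zero_arr_eq[OF O' g Comp_in[OF h f]] by simp
qed

lemma zero_arr_Comp:
  assumes f: "f \<in> Hom C X Y" and "Z \<in> Obj C"
  shows "zero_arr C Y Z \<cdot> f = zero_arr C X Z"
proof (rule zero_arr_factor[OF Hom_Obj(2)[OF f] assms(2)])
  fix O' g h
  assume O': "zero_object C O'" and g: "g \<in> Hom C Y O'" and h: "h \<in> Hom C O' Z"
    and "zero_arr C Y Z = h \<cdot> g"
  then show ?thesis
    using Comp_assoc[OF f g h] zero_arr_eq[OF O' Comp_in[OF f g] h] by simp
qed

lemma inj1:
  assumes "is_product C X Y P p q"
  shows inj1_in: "inj1 C p q \<in> Hom C X P"
    and inj1_proj1: "p \<cdot> inj1 C p q = Ident C X"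
    and inj1_proj2: "q \<cdot> inj1 C p q = zero_arr C X Y"
proof -
  have "X \<in> Obj C" "Y \<in> Obj C" and c: "Cod C p = X" "Cod C q = Y"
    using assms by (auto simp: is_product_def Hom_def)
  then show "inj1 C p q \<in> Hom C X P" "p \<cdot> inj1 C p q = Ident C X" "q \<cdot> inj1 C p q = zero_arr C X Y"
    using pairing[OF assms Ident_in zero_arr_in] unfolding inj1_def by simp_all
qed

lemma inj2:
  assumes "is_product C X Y P p q"
  shows inj2_in: "inj2 C p q \<in> Hom C Y P"
    and inj2_proj1: "p \<cdot> inj2 C p q = zero_arr C Y X"
    and inj2_proj2: "q \<cdot> inj2 C p q = Ident C Y"
proof -
  have "X \<in> Obj C" "Y \<in> Obj C" and c: "Cod C p = X" "Cod C q = Y"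
    using assms by (auto simp: is_product_def Hom_def)
  then show "inj2 C p q \<in> Hom C Y P" "p \<cdot> inj2 C p q = zero_arr C Y X" "q \<cdot> inj2 C p q = Ident C Y"
    using pairing[OF assms zero_arr_in Ident_in] unfolding inj2_def by simp_all
qed

section \<open>Extension along the jointly strongly epic injections, and cooperators\<close>

lemma inj_jointly_epic:
  assumes P: "is_product C X Y P p q" and u: "u \<in> Hom C P Z" and v: "v \<in> Hom C P Z"
    and "u \<cdot> inj1 C p q = v \<cdot> inj1 C p q" and "u \<cdot> inj2 C p q = v \<cdot> inj2 C p q"
  shows "u = v"
  using unital[OF P] assms(2-)
  unfolding jointly_strongly_epic_def jointly_epic_def Hom_Cod[OF inj1_in[OF P]] by blast

text \<open>The diagonal comes from strong epimorphicity. Its two triangles with \<open>u\<close>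
  and \<open>v\<close> commute because they do so after composition with the monomorphism
  \<open>m\<close>.\<close>

lemma inj_fill:
  assumes P: "is_product C X Y P p q" and "monic C m" and m: "m \<in> Hom C S B"
    and h: "h \<in> Hom C P B" and u: "u \<in> Hom C X S" and v: "v \<in> Hom C Y S"
    and mu: "m \<cdot> u = h \<cdot> inj1 C p q" and mv: "m \<cdot> v = h \<cdot> inj2 C p q"
  obtains d where "d \<in> Hom C P S" and "m \<cdot> d = h"
    and "d \<cdot> inj1 C p q = u" and "d \<cdot> inj2 C p q = v"
proof -
  note i = inj1_in[OF P] inj2_in[OF P]
  obtain d where d: "d \<in> Hom C P S" and md: "m \<cdot> d = h"
    using unital[OF P] assms(2-)
    unfolding jointly_strongly_epic_def Hom_Cod[OF i(1)] Hom_Dom[OF i(1)] Hom_Dom[OF i(2)]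
    by (metis Hom_Cod[OF m] Hom_Dom[OF m])
  have "d \<cdot> inj1 C p q = u"
    using \<open>monic C m\<close> mu md u Comp_in[OF i(1) d] Comp_assoc[OF i(1) d m]
    unfolding monic_def Hom_Dom[OF m] by simp
  moreover have "d \<cdot> inj2 C p q = v"
    using \<open>monic C m\<close> mv md v Comp_in[OF i(2) d] Comp_assoc[OF i(2) d m]
    unfolding monic_def Hom_Dom[OF m] by simp
  ultimately show thesis
    using that d md by blast
qed

text \<open>In terms of elements: if the pair \<open>(f, g)\<close> lies in the relation
  \<open>R\<close> on both axes of the product \<open>P\<close>, then it does so on all of
  \<open>P\<close>. The product \<open>AB\<close> serves to pack each pair of morphisms into one, so
  that \<open>inj_fill\<close> applies.\<close>

lemma inj_relation_fill:
  assumes P: "is_product C X Y P p q" and r1: "r\<^sub>1 \<in> Hom C R A" and r2: "r\<^sub>2 \<in> Hom C R B"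
    and jm: "jointly_monic C r\<^sub>1 r\<^sub>2" and AB: "is_product C A B AB a b"
    and f: "f \<in> Hom C P A" and g: "g \<in> Hom C P B"
    and u: "u \<in> Hom C X R" and v: "v \<in> Hom C Y R"
    and u1: "r\<^sub>1 \<cdot> u = f \<cdot> inj1 C p q" and u2: "r\<^sub>2 \<cdot> u = g \<cdot> inj1 C p q"
    and v1: "r\<^sub>1 \<cdot> v = f \<cdot> inj2 C p q" and v2: "r\<^sub>2 \<cdot> v = g \<cdot> inj2 C p q"
  obtains d where "d \<in> Hom C P R" and "r\<^sub>1 \<cdot> d = f" and "r\<^sub>2 \<cdot> d = g"
    and "d \<cdot> inj1 C p q = u" and "d \<cdot> inj2 C p q = v"
proof -
  let ?m = "pairing C a b r\<^sub>1 r\<^sub>2" and ?h = "pairing C a b f g"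
  note m = pairing[OF AB r1 r2] and h = pairing[OF AB f g]
  have a: "a \<in> Hom C AB A" and b: "b \<in> Hom C AB B"
    using AB by (simp_all add: is_product_def)
  \<comment> \<open>Stated for an arbitrary \<open>i\<close> into \<open>P\<close>, to be
    instantiated with both injections.\<close>
  have eq: "?m \<cdot> w = ?h \<cdot> i"
    if w: "w \<in> Hom C W R" and i: "i \<in> Hom C W P" and w1: "r\<^sub>1 \<cdot> w = f \<cdot> i" and w2: "r\<^sub>2 \<cdot> w = g \<cdot> i"
    for W w i
  proof (rule product_eqI[OF AB Comp_in[OF w m(1)] Comp_in[OF i h(1)]])
    show "a \<cdot> (?m \<cdot> w) = a \<cdot> (?h \<cdot> i)"
      using Comp_assoc[OF w m(1) a] Comp_assoc[OF i h(1) a] m h w1 by simp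
    show "b \<cdot> (?m \<cdot> w) = b \<cdot> (?h \<cdot> i)"
      using Comp_assoc[OF w m(1) b] Comp_assoc[OF i h(1) b] m h w2 by simp
  qed
  obtain d where d: "d \<in> Hom C P R" and md: "?m \<cdot> d = ?h"
    and di: "d \<cdot> inj1 C p q = u" "d \<cdot> inj2 C p q = v"
    using inj_fill[OF P monic_pairing[OF AB r1 r2 jm] m(1) h(1) u v
        eq[OF u inj1_in[OF P] u1 u2] eq[OF v inj2_in[OF P] v1 v2]] by blast
  have "r\<^sub>1 \<cdot> d = f" "r\<^sub>2 \<cdot> d = g"
    using Comp_assoc[OF d m(1) a] Comp_assoc[OF d m(1) b] md m h by simp_all
  then show thesis
    using that d di by blast
qed

text \<open>The definition lets the product vary. The comparison morphism between two products of
  the same objects preserves both injections, so a cooperator can be moved to any prescribed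
  product.\<close>

lemma huq_commute_iff:
  assumes P: "is_product C X Y P p q" and f: "f \<in> Hom C X Z" and g: "g \<in> Hom C Y Z"
  shows "huq_commute C f g \<longleftrightarrow> (\<exists>\<phi>\<in>Hom C P Z. \<phi> \<cdot> inj1 C p q = f \<and> \<phi> \<cdot> inj2 C p q = g)"
proof
  assume "huq_commute C f g"
  then obtain P' p' q' \<phi> where P': "is_product C X Y P' p' q'" and \<phi>: "\<phi> \<in> Hom C P' Z"
    and \<phi>f: "\<phi> \<cdot> inj1 C p' q' = f" and \<phi>g: "\<phi> \<cdot> inj2 C p' q' = g"
    unfolding huq_commute_def Hom_Dom[OF f] Hom_Dom[OF g] Hom_Cod[OF f] by blast
  have p: "p \<in> Hom C P X" and q: "q \<in> Hom C P Y"
    and p': "p' \<in> Hom C P' X" and q': "q' \<in> Hom C P' Y"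
    using P P' by (simp_all add: is_product_def)
  let ?t = "pairing C p' q' p q"
  note t = pairing[OF P' p q] and i = inj1[OF P] and i' = inj1[OF P']
    and j = inj2[OF P] and j' = inj2[OF P']
  have "?t \<cdot> inj1 C p q = inj1 C p' q'"
    by (rule product_eqI[OF P' Comp_in[OF i(1) t(1)] i'(1)])
      (use Comp_assoc[OF i(1) t(1) p'] Comp_assoc[OF i(1) t(1) q'] t i i' in simp_all)
  moreover have "?t \<cdot> inj2 C p q = inj2 C p' q'"
    by (rule product_eqI[OF P' Comp_in[OF j(1) t(1)] j'(1)])
      (use Comp_assoc[OF j(1) t(1) p'] Comp_assoc[OF j(1) t(1) q'] t j j' in simp_all)
  ultimately have "(\<phi> \<cdot> ?t) \<cdot> inj1 C p q = f" "(\<phi> \<cdot> ?t) \<cdot> inj2 C p q = g"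
    using Comp_assoc[OF i(1) t(1) \<phi>] Comp_assoc[OF j(1) t(1) \<phi>] \<phi>f \<phi>g by simp_all
  then show "\<exists>\<phi>\<in>Hom C P Z. \<phi> \<cdot> inj1 C p q = f \<and> \<phi> \<cdot> inj2 C p q = g"
    using Comp_in[OF t(1) \<phi>] by blast
next
  assume "\<exists>\<phi>\<in>Hom C P Z. \<phi> \<cdot> inj1 C p q = f \<and> \<phi> \<cdot> inj2 C p q = g"
  then show "huq_commute C f g"
    using P Hom_Arr[OF f] Hom_Arr[OF g]
    unfolding huq_commute_def Hom_Dom[OF f] Hom_Dom[OF g] Hom_Cod[OF f] Hom_Cod[OF g] by blast
qed

end

section \<open>The equivalence of the three conditions\<close>

theorem theorem3p2:
  fixes C :: "('o, 'm) category" (structure)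
  assumes "unital_category C"
    and "is_product C A A AA a\<^sub>1 a\<^sub>2"
    and "is_product C X Y XY \<pi>\<^sub>1 \<pi>\<^sub>2"
    and "k \<in> Hom C X A" and "monic C k"
    and "l \<in> Hom C Y A" and "monic C l"
    and "internal_equivalence C A R r\<^sub>1 r\<^sub>2"
    and "internal_equivalence C A S s\<^sub>1 s\<^sub>2"
    and "\<kappa> \<in> Hom C X R" and "lam \<in> Hom C Y S"
    and "is_pullback C X \<kappa> k (pairing C a\<^sub>1 a\<^sub>2 r\<^sub>1 r\<^sub>2) (inj1 C a\<^sub>1 a\<^sub>2)"
    and "is_pullback C Y lam l (pairing C a\<^sub>1 a\<^sub>2 s\<^sub>1 s\<^sub>2) (inj2 C a\<^sub>1 a\<^sub>2)"
    \<comment> \<open>\<open>Q\<close> is the object written \<open>R \<box>\<^sup>0 S\<close>\<close>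
    and "is_pullback C P p\<^sub>1 p\<^sub>2 s\<^sub>2 r\<^sub>1"
    and "is_pullback C Q \<theta> \<psi> (prod_arr C \<pi>\<^sub>1 \<pi>\<^sub>2 a\<^sub>1 a\<^sub>2 k l)
           (pairing C a\<^sub>1 a\<^sub>2 (s\<^sub>1 \<cdot> p\<^sub>1) (r\<^sub>2 \<cdot> p\<^sub>2))"
    and "e\<^sub>R \<in> Hom C A R" and "r\<^sub>1 \<cdot> e\<^sub>R = Ident C A" and "r\<^sub>2 \<cdot> e\<^sub>R = Ident C A"
    and "e\<^sub>S \<in> Hom C A S" and "s\<^sub>1 \<cdot> e\<^sub>S = Ident C A" and "s\<^sub>2 \<cdot> e\<^sub>S = Ident C A"
    and "\<alpha> \<in> Hom C X Q"
    and "\<pi>\<^sub>1 \<cdot> \<theta> \<cdot> \<alpha> = Ident C X" and "p\<^sub>1 \<cdot> \<psi> \<cdot> \<alpha> = e\<^sub>S \<cdot> k"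
    and "p\<^sub>2 \<cdot> \<psi> \<cdot> \<alpha> = \<kappa>" and "\<pi>\<^sub>2 \<cdot> \<theta> \<cdot> \<alpha> = zero_arr C X Y"
    and "\<beta> \<in> Hom C Y Q"
    and "\<pi>\<^sub>1 \<cdot> \<theta> \<cdot> \<beta> = zero_arr C Y X" and "p\<^sub>1 \<cdot> \<psi> \<cdot> \<beta> = lam"
    and "p\<^sub>2 \<cdot> \<psi> \<cdot> \<beta> = e\<^sub>R \<cdot> l" and "\<pi>\<^sub>2 \<cdot> \<theta> \<cdot> \<beta> = Ident C Y"
  shows "(huq_commute C k l \<longleftrightarrow> huq_commute C \<alpha> \<beta>) \<and>
         (huq_commute C \<alpha> \<beta> \<longleftrightarrow>
            split_epi_of_cospans C (Q, \<alpha>, \<beta>) (XY, inj1 C \<pi>\<^sub>1 \<pi>\<^sub>2, inj2 C \<pi>\<^sub>1 \<pi>\<^sub>2) \<theta>)"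
proof -
  interpret unital_category C by fact
  note AA = assms(2) and XY = assms(3) and k = assms(4) and l = assms(6)
    and \<kappa> = assms(10) and lam = assms(11) and pbk = assms(12) and pbl = assms(13)
    and pbP = assms(14) and pbQ = assms(15) and eR = assms(16-18) and eS = assms(19-21)
    and \<alpha> = assms(22) and \<beta> = assms(27)
  have obj: "A \<in> Obj C" "X \<in> Obj C" "Y \<in> Obj C"
    using Hom_Obj k l by blast+
  have a: "a\<^sub>1 \<in> Hom C AA A" "a\<^sub>2 \<in> Hom C AA A"
    and \<pi>: "\<pi>\<^sub>1 \<in> Hom C XY X" "\<pi>\<^sub>2 \<in> Hom C XY Y"
    using AA XY by (simp_all add: is_product_def)
  have r: "r\<^sub>1 \<in> Hom C R A" "r\<^sub>2 \<in> Hom C R A" "jointly_monic C r\<^sub>1 r\<^sub>2"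
    and s: "s\<^sub>1 \<in> Hom C S A" "s\<^sub>2 \<in> Hom C S A" "jointly_monic C s\<^sub>1 s\<^sub>2"
    using assms(8,9) by (simp_all add: internal_equivalence_def)
  have p: "p\<^sub>1 \<in> Hom C P S" "p\<^sub>2 \<in> Hom C P R" and sp: "s\<^sub>2 \<cdot> p\<^sub>1 = r\<^sub>1 \<cdot> p\<^sub>2"
    using pbP unfolding is_pullback_def Hom_Dom[OF s(2)] Hom_Dom[OF r(1)] by blast+
  let ?kl = "prod_arr C \<pi>\<^sub>1 \<pi>\<^sub>2 a\<^sub>1 a\<^sub>2 k l" and ?sr = "pairing C a\<^sub>1 a\<^sub>2 (s\<^sub>1 \<cdot> p\<^sub>1) (r\<^sub>2 \<cdot> p\<^sub>2)"
  let ?i = "inj1 C \<pi>\<^sub>1 \<pi>\<^sub>2" and ?j = "inj2 C \<pi>\<^sub>1 \<pi>\<^sub>2"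
  have k\<pi>: "k \<cdot> \<pi>\<^sub>1 \<in> Hom C XY A" and l\<pi>: "l \<cdot> \<pi>\<^sub>2 \<in> Hom C XY A"
    using Comp_in \<pi> k l by blast+
  note kl = pairing[OF AA k\<pi> l\<pi>, folded prod_arr_def]
  note sr = pairing[OF AA Comp_in[OF p(1) s(1)] Comp_in[OF p(2) r(2)]]
  have \<theta>: "\<theta> \<in> Hom C Q XY" and \<psi>: "\<psi> \<in> Hom C Q P"
    using pbQ unfolding is_pullback_def Hom_Dom[OF kl(1)] Hom_Dom[OF sr(1)] by blast+
  note i = inj1[OF XY] and j = inj2[OF XY]

  \<comment> \<open>Projecting the commutative square to both factors shows that \<kappa> represents
    the pair \<open>(k, 0)\<close> in \<open>R\<close>; in the same way \<open>lam\<close>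
    represents \<open>(0, l)\<close> in \<open>S\<close>.\<close>
  have r\<kappa>: "r\<^sub>1 \<cdot> \<kappa> = k" "r\<^sub>2 \<cdot> \<kappa> = zero_arr C X A"
  proof -
    note m = pairing[OF AA r(1,2)] and n = inj1[OF AA]
    have sq: "pairing C a\<^sub>1 a\<^sub>2 r\<^sub>1 r\<^sub>2 \<cdot> \<kappa> = inj1 C a\<^sub>1 a\<^sub>2 \<cdot> k"
      using pbk by (simp add: is_pullback_def)
    show "r\<^sub>1 \<cdot> \<kappa> = k"
      using Comp_assoc[OF \<kappa> m(1) a(1)] Comp_assoc[OF k n(1) a(1)] m n sq Ident_left[OF k] by simp
    show "r\<^sub>2 \<cdot> \<kappa> = zero_arr C X A"
      using Comp_assoc[OF \<kappa> m(1) a(2)] Comp_assoc[OF k n(1) a(2)] m n sq zero_arr_Comp[OF k obj(1)]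
      by simp
  qed
  have slam: "s\<^sub>1 \<cdot> lam = zero_arr C Y A" "s\<^sub>2 \<cdot> lam = l"
  proof -
    note m = pairing[OF AA s(1,2)] and n = inj2[OF AA]
    have sq: "pairing C a\<^sub>1 a\<^sub>2 s\<^sub>1 s\<^sub>2 \<cdot> lam = inj2 C a\<^sub>1 a\<^sub>2 \<cdot> l"
      using pbl by (simp add: is_pullback_def)
    show "s\<^sub>1 \<cdot> lam = zero_arr C Y A"
      using Comp_assoc[OF lam m(1) a(1)] Comp_assoc[OF l n(1) a(1)] m n sq zero_arr_Comp[OF l obj(1)]
      by simp
    show "s\<^sub>2 \<cdot> lam = l"
      using Comp_assoc[OF lam m(1) a(2)] Comp_assoc[OF l n(1) a(2)] m n sq Ident_left[OF l] by simp
  qed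

  \<comment> \<open>By reflexivity the pairs \<open>(k, k)\<close> and \<open>(l, l)\<close> lie in
    \<open>S\<close> and \<open>R\<close> respectively.\<close>
  have ek: "e\<^sub>S \<cdot> k \<in> Hom C X S" "s\<^sub>1 \<cdot> (e\<^sub>S \<cdot> k) = k" "s\<^sub>2 \<cdot> (e\<^sub>S \<cdot> k) = k"
    using Comp_in[OF k eS(1)] Comp_assoc[OF k eS(1) s(1)] Comp_assoc[OF k eS(1) s(2)] eS
      Ident_left[OF k] by simp_all
  have el: "e\<^sub>R \<cdot> l \<in> Hom C Y R" "r\<^sub>1 \<cdot> (e\<^sub>R \<cdot> l) = l" "r\<^sub>2 \<cdot> (e\<^sub>R \<cdot> l) = l"
    using Comp_in[OF l eR(1)] Comp_assoc[OF l eR(1) r(1)] Comp_assoc[OF l eR(1) r(2)] eR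
      Ident_left[OF l] by simp_all

  have \<psi>\<alpha>: "p\<^sub>1 \<cdot> (\<psi> \<cdot> \<alpha>) = e\<^sub>S \<cdot> k" "p\<^sub>2 \<cdot> (\<psi> \<cdot> \<alpha>) = \<kappa>"
    using Comp_assoc[OF \<alpha> \<psi> p(1)] Comp_assoc[OF \<alpha> \<psi> p(2)] assms(24,25) by simp_all
  have \<psi>\<beta>: "p\<^sub>1 \<cdot> (\<psi> \<cdot> \<beta>) = lam" "p\<^sub>2 \<cdot> (\<psi> \<cdot> \<beta>) = e\<^sub>R \<cdot> l"
    using Comp_assoc[OF \<beta> \<psi> p(1)] Comp_assoc[OF \<beta> \<psi> p(2)] assms(29,30) by simp_all
  have \<theta>\<alpha>: "\<theta> \<cdot> \<alpha> = ?i"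
    by (rule product_eqI[OF XY Comp_in[OF \<alpha> \<theta>] i(1)])
      (use Comp_assoc[OF \<alpha> \<theta> \<pi>(1)] Comp_assoc[OF \<alpha> \<theta> \<pi>(2)] i assms(23,26) in simp_all)
  have \<theta>\<beta>: "\<theta> \<cdot> \<beta> = ?j"
    by (rule product_eqI[OF XY Comp_in[OF \<beta> \<theta>] j(1)])
      (use Comp_assoc[OF \<beta> \<theta> \<pi>(1)] Comp_assoc[OF \<beta> \<theta> \<pi>(2)] j assms(28,31) in simp_all)

  \<comment> \<open>\<theta> is already a morphism of cospans by \<open>\<theta>\<alpha>\<close> and
    \<open>\<theta>\<beta>\<close>, so only the section remains to be found.\<close>
  have split_iff: "split_epi_of_cospans C (Q, \<alpha>, \<beta>) (XY, ?i, ?j) \<theta> \<longleftrightarrow>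
      (\<exists>\<sigma>\<in>Hom C XY Q. \<sigma> \<cdot> ?i = \<alpha> \<and> \<sigma> \<cdot> ?j = \<beta> \<and> \<theta> \<cdot> \<sigma> = Ident C XY)"
    using \<theta> \<theta>\<alpha> \<theta>\<beta> unfolding split_epi_of_cospans_def cospan_morphism_def by auto

  have bc: "split_epi_of_cospans C (Q, \<alpha>, \<beta>) (XY, ?i, ?j) \<theta>" if ab: "huq_commute C \<alpha> \<beta>"
  proof -
    obtain \<phi> where \<phi>: "\<phi> \<in> Hom C XY Q" "\<phi> \<cdot> ?i = \<alpha>" "\<phi> \<cdot> ?j = \<beta>"
      using ab unfolding huq_commute_iff[OF XY \<alpha> \<beta>] by blast
    have "\<theta> \<cdot> \<phi> = Ident C XY"
      by (rule inj_jointly_epic[OF XY Comp_in[OF \<phi>(1) \<theta>] Ident_in[OF Hom_Obj(2)[OF \<theta>]]])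
        (use Comp_assoc[OF i(1) \<phi>(1) \<theta>] Comp_assoc[OF j(1) \<phi>(1) \<theta>] \<phi> \<theta>\<alpha> \<theta>\<beta>
          Ident_left[OF i(1)] Ident_left[OF j(1)] in simp_all)
    then show ?thesis
      using \<phi> unfolding split_iff by blast
  qed

  have cb: "huq_commute C \<alpha> \<beta>" if "split_epi_of_cospans C (Q, \<alpha>, \<beta>) (XY, ?i, ?j) \<theta>"
    using that unfolding split_iff huq_commute_iff[OF XY \<alpha> \<beta>] by blast

  have ba: "huq_commute C k l" if ab: "huq_commute C \<alpha> \<beta>"
  proof -
    obtain \<phi> where \<phi>: "\<phi> \<in> Hom C XY Q" "\<phi> \<cdot> ?i = \<alpha>" "\<phi> \<cdot> ?j = \<beta>"
      using ab unfolding huq_commute_iff[OF XY \<alpha> \<beta>] by blast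
    \<comment> \<open>On a triple \<open>(x, a, y)\<close> of \<open>Q\<close> this is the middle
      entry \<open>a\<close>; \<alpha> sends \<open>x\<close> to \<open>(x, k x, 0)\<close> and
      \<beta> sends \<open>y\<close> to \<open>(0, l y, y)\<close>.\<close>
    let ?t = "s\<^sub>2 \<cdot> (p\<^sub>1 \<cdot> \<psi>)"
    have t: "?t \<in> Hom C Q A"
      using Comp_in[OF Comp_in[OF \<psi> p(1)] s(2)] .
    have "?t \<cdot> \<alpha> = k"
      using Comp_assoc[OF \<alpha> Comp_in[OF \<psi> p(1)] s(2)] Comp_assoc[OF \<alpha> \<psi> p(1)] \<psi>\<alpha> ek by simp
    moreover have "?t \<cdot> \<beta> = l"
      using Comp_assoc[OF \<beta> Comp_in[OF \<psi> p(1)] s(2)] Comp_assoc[OF \<beta> \<psi> p(1)] \<psi>\<beta> slam by simp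
    ultimately have "(?t \<cdot> \<phi>) \<cdot> ?i = k" "(?t \<cdot> \<phi>) \<cdot> ?j = l"
      using Comp_assoc[OF i(1) \<phi>(1) t] Comp_assoc[OF j(1) \<phi>(1) t] \<phi> by simp_all
    then show ?thesis
      using Comp_in[OF \<phi>(1) t] unfolding huq_commute_iff[OF XY k l] by blast
  qed

  have ac: "split_epi_of_cospans C (Q, \<alpha>, \<beta>) (XY, ?i, ?j) \<theta>" if kl_commute: "huq_commute C k l"
  proof -
    obtain \<phi> where \<phi>: "\<phi> \<in> Hom C XY A" "\<phi> \<cdot> ?i = k" "\<phi> \<cdot> ?j = l"
      using kl_commute unfolding huq_commute_iff[OF XY k l] by blast
    have k\<pi>i: "(k \<cdot> \<pi>\<^sub>1) \<cdot> ?i = k" "(k \<cdot> \<pi>\<^sub>1) \<cdot> ?j = zero_arr C Y A"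
      using Comp_assoc[OF i(1) \<pi>(1) k] Comp_assoc[OF j(1) \<pi>(1) k] i j
        Ident_right[OF k] Comp_zero_arr[OF obj(3) k] by simp_all
    have l\<pi>i: "(l \<cdot> \<pi>\<^sub>2) \<cdot> ?i = zero_arr C X A" "(l \<cdot> \<pi>\<^sub>2) \<cdot> ?j = l"
      using Comp_assoc[OF i(1) \<pi>(2) l] Comp_assoc[OF j(1) \<pi>(2) l] i j
        Ident_right[OF l] Comp_zero_arr[OF obj(2) l] by simp_all
    \<comment> \<open>In terms of elements, \<open>c\<close> says that
      \<open>(k x, \<phi>(x, y))\<close> is in \<open>S\<close>, and \<open>d\<close> below that
      \<open>(\<phi>(x, y), l y)\<close> is in \<open>R\<close>.\<close>
    obtain c where c: "c \<in> Hom C XY S" "s\<^sub>1 \<cdot> c = k \<cdot> \<pi>\<^sub>1" "s\<^sub>2 \<cdot> c = \<phi>"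
      and ci: "c \<cdot> ?i = e\<^sub>S \<cdot> k" "c \<cdot> ?j = lam"
      by (rule inj_relation_fill[OF XY s AA k\<pi> \<phi>(1) ek(1) lam]) (use ek slam k\<pi>i \<phi> in simp_all)
    obtain d where d: "d \<in> Hom C XY R" "r\<^sub>1 \<cdot> d = \<phi>" "r\<^sub>2 \<cdot> d = l \<cdot> \<pi>\<^sub>2"
      and di: "d \<cdot> ?i = \<kappa>" "d \<cdot> ?j = e\<^sub>R \<cdot> l"
      by (rule inj_relation_fill[OF XY r AA \<phi>(1) l\<pi> \<kappa> el(1)]) (use el r\<kappa> l\<pi>i \<phi> in simp_all)
    \<comment> \<open>Both sides are \<phi>, the common middle entry, so \<open>c\<close> and
      \<open>d\<close> glue to a morphism into \<open>P\<close>.\<close>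
    have "s\<^sub>2 \<cdot> c = r\<^sub>1 \<cdot> d"
      using c d by simp
    then obtain w where w: "w \<in> Hom C XY P" "p\<^sub>1 \<cdot> w = c" "p\<^sub>2 \<cdot> w = d"
      using pullback_induced[OF pbP s(2) r(1) c(1) d(1)] by blast
    note id = Ident_in[OF Hom_Obj(2)[OF \<theta>]]
    \<comment> \<open>The outer entries of the glued chain are \<open>k x\<close> and
      \<open>l y\<close>, as membership in \<open>Q\<close> demands.\<close>
    have "?kl = ?sr \<cdot> w"
    proof (rule product_eqI[OF AA kl(1) Comp_in[OF w(1) sr(1)]])
      show "a\<^sub>1 \<cdot> ?kl = a\<^sub>1 \<cdot> (?sr \<cdot> w)"
        using Comp_assoc[OF w(1) sr(1) a(1)] Comp_assoc[OF w(1) p(1) s(1)] kl sr w c by simp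
      show "a\<^sub>2 \<cdot> ?kl = a\<^sub>2 \<cdot> (?sr \<cdot> w)"
        using Comp_assoc[OF w(1) sr(1) a(2)] Comp_assoc[OF w(1) p(2) r(2)] kl sr w d by simp
    qed
    then have "?kl \<cdot> Ident C XY = ?sr \<cdot> w"
      using Ident_right[OF kl(1)] by simp
    \<comment> \<open>\<sigma> sends \<open>(x, y)\<close> to \<open>(x, \<phi>(x, y), y)\<close>.
      Taking the identity as the first leg of the cone makes it a section of \<theta> by
      construction.\<close>
    then obtain \<sigma> where \<sigma>: "\<sigma> \<in> Hom C XY Q" "\<theta> \<cdot> \<sigma> = Ident C XY" "\<psi> \<cdot> \<sigma> = w"
      using pullback_induced[OF pbQ kl(1) sr(1) id w(1)] by blast
    \<comment> \<open>A morphism into \<open>Q\<close> is determined by its composites with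
      \<theta>, \<open>p\<^sub>1 \<cdot> \<psi>\<close> and \<open>p\<^sub>2 \<cdot> \<psi>\<close>.
      This is applied with \<open>v\<close> equal to \<alpha> and \<beta>, and \<open>u\<close> the
      matching injection.\<close>
    have \<sigma>_comp: "\<sigma> \<cdot> u = v"
      if u: "u \<in> Hom C W XY" and v: "v \<in> Hom C W Q" and "\<theta> \<cdot> v = u"
        and "p\<^sub>1 \<cdot> (\<psi> \<cdot> v) = c \<cdot> u" and "p\<^sub>2 \<cdot> (\<psi> \<cdot> v) = d \<cdot> u" for W u v
    proof (rule pullback_eqI[OF pbQ Comp_in[OF u \<sigma>(1)] v])
      show "\<theta> \<cdot> (\<sigma> \<cdot> u) = \<theta> \<cdot> v"
        using Comp_assoc[OF u \<sigma>(1) \<theta>] \<sigma> Ident_left[OF u] that by simp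
      have "w \<cdot> u = \<psi> \<cdot> v"
        by (rule pullback_eqI[OF pbP Comp_in[OF u w(1)] Comp_in[OF v \<psi>]])
          (use Comp_assoc[OF u w(1) p(1)] Comp_assoc[OF u w(1) p(2)] w that in simp_all)
      then show "\<psi> \<cdot> (\<sigma> \<cdot> u) = \<psi> \<cdot> v"
        using Comp_assoc[OF u \<sigma>(1) \<psi>] \<sigma> by simp
    qed
    have "\<sigma> \<cdot> ?i = \<alpha>" "\<sigma> \<cdot> ?j = \<beta>"
      using \<sigma>_comp[OF i(1) \<alpha>] \<sigma>_comp[OF j(1) \<beta>] \<theta>\<alpha> \<theta>\<beta> \<psi>\<alpha> \<psi>\<beta> ci di by simp_all
    then show ?thesis
      using \<sigma> unfolding split_iff by blast
  qed

  show ?thesis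
    \<comment> \<open>The cycle is (a) to (c) to (b) to (a), together with (b) to (c).\<close>
    using ac ba bc cb by blast
qed

end
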